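(* Let $1\le r\le s$, let $A\in\mathbb{C}_r^{m\times n}$ and $B\in\mathbb{C}_s^{m\times n}$, and let $\sigma_1\ge\dots\ge\sigma_r>0$ and $\widehat\sigma_1\ge\dots\ge\widehat\sigma_s>0$ be the nonzero singular values of $A$ and $B$, respectively. Then $$\|AB^*\|_F\le\left(\frac{\sum_{j=1}^r\sigma_j^2\widehat\sigma_j^2}{\sum_{j=1}^r\sigma_j^4+\sum_{j=1}^s\widehat\sigma_j^4+2\sum_{j=1}^r\sigma_j^2\widehat\sigma_j^2}\right)^{1/2}\big\||A|^2+|B|^2\big\|_F .$$ Moreover the coefficient is optimal: for given $m,n$ and given $\sigma_1\ge\dots\ge\sigma_r>0$, $\widehat\sigma_1\ge\dots\ge\widehat\sigma_s>0$ with $s\le\min(m,n)$, it cannot be replaced by any smaller number so that the inequality still holds for all $A\in\mathbb{C}_r^{m\times n}$, $B\in\mathbb{C}_s^{m\times n}$ with these nonzero singular values.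
   Context: $\mathbb{C}^{m\times n}_r$ denotes the set of complex $m\times n$ matrices of rank $r$; $\|\cdot\|_F$ is the Frobenius norm; $A^*$ is the conjugate transpose and $|A|:=(A^*A)^{1/2}$. *)

theory Defs
  imports
    Complex_Main
    "Jordan_Normal_Form.Schur_Decomposition"
    "Jordan_Normal_Form.DL_Rank"
begin

definition rank_mats :: "nat \<Rightarrow> nat \<Rightarrow> nat \<Rightarrow> complex mat set" where
  "rank_mats m n r = {A \<in> carrier_mat m n. vec_space.rank m A = r}"

definition frob_norm :: "complex mat \<Rightarrow> real" where
  "frob_norm A = sqrt (\<Sum>i<dim_row A. \<Sum>j<dim_col A. (cmod (A $$ (i, j)))\<^sup>2)"

definition psd_mat :: "nat \<Rightarrow> complex mat \<Rightarrow> bool" where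
  "psd_mat n P \<longleftrightarrow> P \<in> carrier_mat n n \<and> mat_adjoint P = P \<and>
     (\<forall>v \<in> carrier_vec n. 0 \<le> Re ((P *\<^sub>v v) \<bullet>c v))"

text \<open>A positive semidefinite matrix has exactly one positive semidefinite square root;
  for other arguments the value is unspecified.\<close>

definition mat_sqrt :: "complex mat \<Rightarrow> complex mat" where
  "mat_sqrt P = (THE Q. psd_mat (dim_row P) Q \<and> Q * Q = P)"

definition mat_abs :: "complex mat \<Rightarrow> complex mat" where
  "mat_abs A = mat_sqrt (mat_adjoint A * A)"

text \<open>The nonzero singular values in non-increasing order: the square roots of the nonzero
  eigenvalues of \<open>A\<^sup>*A\<close>, listed with (algebraic = geometric) multiplicity. These eigenvalues
  are real and nonnegative, so passing to the real part loses nothing.\<close>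

definition nonzero_sing_vals :: "complex mat \<Rightarrow> real list" where
  "nonzero_sing_vals A = rev (sorted_list_of_multiset
     (image_mset (\<lambda>z. sqrt (Re z))
       (filter_mset (\<lambda>z. z \<noteq> 0) (proots (char_poly (mat_adjoint A * A))))))"

definition sv_coeff :: "nat \<Rightarrow> nat \<Rightarrow> (nat \<Rightarrow> real) \<Rightarrow> (nat \<Rightarrow> real) \<Rightarrow> real" where
  "sv_coeff r s \<sigma> \<tau> =
     sqrt ((\<Sum>j=1..r. (\<sigma> j)\<^sup>2 * (\<tau> j)\<^sup>2) /
       ((\<Sum>j=1..r. (\<sigma> j) ^ 4) + (\<Sum>j=1..s. (\<tau> j) ^ 4) + 2 * (\<Sum>j=1..r. (\<sigma> j)\<^sup>2 * (\<tau> j)\<^sup>2)))"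

end

theory Submission
  imports Defs
begin

text \<open>
Write \<open>P = A\<^sup>* A\<close> and \<open>Q = B\<^sup>* B\<close>, and let \<open>t = tr (P Q)\<close>. Cyclicity of the trace gives
\<open>\<parallel>A B\<^sup>*\<parallel>\<^sub>F\<^sup>2 = t\<close>, and since \<open>|A|\<^sup>2 = P\<close> and \<open>|B|\<^sup>2 = Q\<close>, expanding the square gives
\<open>\<parallel>|A|\<^sup>2 + |B|\<^sup>2\<parallel>\<^sub>F\<^sup>2 = tr (P\<^sup>2) + tr (Q\<^sup>2) + 2 t = S + 2 t\<close>, where \<open>S\<close> is the sum of the fourth powers of
all the singular values of \<open>A\<close> and \<open>B\<close>. So the squared quotient of the two norms is
\<open>t / (S + 2 t)\<close> with \<open>S\<close> fixed, which increases with \<open>t\<close> (\<open>fraction_bound\<close>), and the question is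
how large \<open>t\<close> can be. By von Neumann's trace inequality (\<open>von_neumann_trace_inequality\<close>) the maximum
is the sum \<open>T\<close> of the products \<open>\<sigma>\<^sub>j\<^sup>2 \<tau>\<^sub>j\<^sup>2\<close>, which yields the coefficient \<open>(T / (S + 2 T))\<^sup>1\<^sup>/\<^sup>2\<close>. For
rectangular diagonal matrices with the given singular values in decreasing order \<open>t = T\<close>
(\<open>rect_diag_equality\<close>), so no smaller coefficient works.

The trace inequality rests on two facts. The spectral theorem (\<open>hermitian_diagonalization\<close>) writes
\<open>P\<close> and \<open>Q\<close> in orthonormal eigenbases, so that \<open>t\<close> pairs their eigenvalues with the doubly
stochastic weights \<open>|W\<^sub>i\<^sub>j|\<^sup>2\<close> of the unitary matrix \<open>W\<close> between the bases. The rearrangement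
inequality \<open>doubly_substochastic_rearrangement\<close> says that such weights pair two decreasing sequences
best when they are concentrated on the diagonal. The spectral theorem also provides existence and
uniqueness of the positive semidefinite square root, so that \<open>|A|\<^sup>2 = A\<^sup>* A\<close>
(\<open>mat_abs_square\<close>).
\<close>

section \<open>The conjugate transpose\<close>

lemma mat_adjoint_dim [simp]:
  "dim_row (mat_adjoint A) = dim_col A" "dim_col (mat_adjoint A) = dim_row A"
  by (simp_all add: mat_adjoint_def)

lemma mat_adjoint_carrier [simp]:
  "A \<in> carrier_mat m n \<Longrightarrow> mat_adjoint A \<in> carrier_mat n m"
  by (intro carrier_matI) (simp_all add: mat_adjoint_def)

lemma mat_adjoint_index [simp]:
  "i < dim_col A \<Longrightarrow> j < dim_row A \<Longrightarrow> mat_adjoint A $$ (i, j) = conjugate (A $$ (j, i))"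
  by (simp add: mat_adjoint_def mat_of_rows_def)

lemma mat_adjoint_adjoint [simp]: "mat_adjoint (mat_adjoint (A :: complex mat)) = A"
  by (rule eq_matI) auto

lemma mult_index_sum:
  assumes "A \<in> carrier_mat m k" "B \<in> carrier_mat k n" "i < m" "j < n"
  shows "(A * B) $$ (i, j) = (\<Sum>l<k. A $$ (i, l) * B $$ (l, j))"
  using assms by (auto simp: scalar_prod_def atLeast0LessThan)

lemma square_mult_closed [simp]:
  "A \<in> carrier_mat n n \<Longrightarrow> B \<in> carrier_mat n n \<Longrightarrow> A * B \<in> carrier_mat n n"
  by simp


lemma mat_adjoint_mult:
  fixes A B :: "complex mat"
  assumes A: "A \<in> carrier_mat m k" and B: "B \<in> carrier_mat k n"
  shows "mat_adjoint (A * B) = mat_adjoint B * mat_adjoint A"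
proof (rule eq_matI)
  fix i j assume "i < dim_row (mat_adjoint B * mat_adjoint A)" "j < dim_col (mat_adjoint B * mat_adjoint A)"
  then have ij: "i < n" "j < m" using A B by auto
  have "mat_adjoint (A * B) $$ (i, j) = cnj ((A * B) $$ (j, i))"
    using ij A B by (subst mat_adjoint_index) auto
  also have "\<dots> = cnj (\<Sum>l<k. A $$ (j, l) * B $$ (l, i))"
    unfolding mult_index_sum[OF A B ij(2,1)] ..
  also have "\<dots> = (\<Sum>l<k. mat_adjoint B $$ (i, l) * mat_adjoint A $$ (l, j))"
    unfolding cnj_sum by (rule sum.cong) (use ij A B in auto)
  also have "\<dots> = (mat_adjoint B * mat_adjoint A) $$ (i, j)"
    unfolding mult_index_sum[OF mat_adjoint_carrier[OF B] mat_adjoint_carrier[OF A] ij] ..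
  finally show "mat_adjoint (A * B) $$ (i, j) = (mat_adjoint B * mat_adjoint A) $$ (i, j)" .
qed (use A B in auto)

lemma mat_adjoint_add:
  fixes A B :: "complex mat"
  assumes "A \<in> carrier_mat m n" "B \<in> carrier_mat m n"
  shows "mat_adjoint (A + B) = mat_adjoint A + mat_adjoint B"
  using assms by (intro eq_matI) auto

lemma mat_adjoint_diff:
  fixes A B :: "complex mat"
  assumes "A \<in> carrier_mat m n" "B \<in> carrier_mat m n"
  shows "mat_adjoint (A - B) = mat_adjoint A - mat_adjoint B"
  using assms by (intro eq_matI) auto

lemma mat_adjoint_mat_diag_real:
  "mat_adjoint (mat_diag n (\<lambda>i. complex_of_real (f i))) = mat_diag n (\<lambda>i. complex_of_real (f i))"
  by (rule eq_matI) (auto simp: mat_diag_def)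

lemma adjoint_cscalar_prod:
  fixes A :: "complex mat"
  assumes A: "A \<in> carrier_mat m n" and "v \<in> carrier_vec n" "w \<in> carrier_vec m"
  shows "(A *\<^sub>v v) \<bullet>c w = v \<bullet>c (mat_adjoint A *\<^sub>v w)"
proof -
  have "(A *\<^sub>v v) \<bullet>c w = (\<Sum>i<m. \<Sum>j<n. A $$ (i, j) * v $ j * cnj (w $ i))"
    using assms by (auto simp: scalar_prod_def atLeast0LessThan sum_distrib_right intro!: sum.cong)
  also have "\<dots> = (\<Sum>j<n. \<Sum>i<m. A $$ (i, j) * v $ j * cnj (w $ i))"
    by (rule sum.swap)
  also have "\<dots> = v \<bullet>c (mat_adjoint A *\<^sub>v w)"
    using assms by (auto simp: scalar_prod_def atLeast0LessThan sum_distrib_left mult_ac intro!: sum.cong)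
  finally show ?thesis .
qed

section \<open>Unitary matrices and diagonalization of Hermitian matrices\<close>

definition unitary_mat :: "nat \<Rightarrow> complex mat \<Rightarrow> bool" where
  "unitary_mat n U \<longleftrightarrow> U \<in> carrier_mat n n \<and> mat_adjoint U * U = 1\<^sub>m n"

lemma unitary_matD:
  assumes "unitary_mat n U"
  shows "U \<in> carrier_mat n n" "mat_adjoint U * U = 1\<^sub>m n" "U * mat_adjoint U = 1\<^sub>m n"
proof -
  show U: "U \<in> carrier_mat n n" and UU: "mat_adjoint U * U = 1\<^sub>m n"
    using assms by (auto simp: unitary_mat_def)
  show "U * mat_adjoint U = 1\<^sub>m n"
    using mat_mult_left_right_inverse[OF mat_adjoint_carrier[OF U] U UU] .
qed

lemma unitary_mat_mult:
  assumes "unitary_mat n U" "unitary_mat n V"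
  shows "unitary_mat n (U * V)"
proof -
  note U = unitary_matD[OF assms(1)] and V = unitary_matD[OF assms(2)]
  have "mat_adjoint (U * V) * (U * V) = mat_adjoint V * (mat_adjoint U * U) * V"
    using U(1) V(1) by (simp add: mat_adjoint_mult[OF U(1) V(1)] assoc_mult_mat[of _ n n _ n _ n])
  also have "\<dots> = 1\<^sub>m n" using U V by simp
  finally show ?thesis using U V by (simp add: unitary_mat_def)
qed

lemma unitary_mat_adjoint:
  assumes "unitary_mat n U"
  shows "unitary_mat n (mat_adjoint U)"
  using unitary_matD(1,3)[OF assms] by (simp add: unitary_mat_def)

lemma cscalar_prod_self:
  fixes w :: "complex vec"
  shows "w \<bullet>c w = complex_of_real (\<Sum>i<dim_vec w. (cmod (w $ i))\<^sup>2)"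
  unfolding scalar_prod_def 
  by (auto simp: atLeast0LessThan complex_norm_square intro!: sum.cong simp del: of_real_power)

text \<open>Gram-Schmidt keeps the first vector of a basis that starts with \<open>v\<close>; dividing the resulting
orthogonal vectors by their lengths only rescales that first column.\<close>

lemma unitary_completion:
  fixes v :: "complex vec"
  assumes v: "v \<in> carrier_vec n" and v0: "v \<noteq> 0\<^sub>v n"
  shows "\<exists>W c. unitary_mat n W \<and> col W 0 = c \<cdot>\<^sub>v v"
proof -
  interpret cof_vec_space n "TYPE(complex)" .
  define b where "b = basis_completion v"
  define ws where "ws = gram_schmidt n b"
  note bc = basis_completion[OF v v0, folded b_def]
  have n: "n \<noteq> 0" using v v0 by (auto intro!: eq_vecI)
  obtain vs where bv: "b = v # vs" using bc n by (cases b) auto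
  from gram_schmidt_result[OF bc(2,4,5) refl, folded ws_def]
  have ws: "set ws \<subseteq> carrier_vec n" "corthogonal ws" "length ws = n"
    by (auto simp: bc(6))
  have hdws: "ws ! 0 = v"
    using gram_schmidt_hd[OF v, of vs, folded bv] ws(3) n unfolding ws_def[symmetric]
    by (cases ws) auto
  define c where "c w = complex_of_real (1 / sqrt (\<Sum>i<n. (cmod (w $ i))\<^sup>2))" for w
  have cnj_c: "cnj (c w) = c w" for w by (simp add: c_def)
  define W where "W = mat n n (\<lambda>(i, j). c (ws ! j) * ws ! j $ i)"
  have W: "W \<in> carrier_mat n n" by (simp add: W_def)
  have wsc: "ws ! i \<in> carrier_vec n" if "i < n" for i using ws that by auto
  have "mat_adjoint W * W = 1\<^sub>m n"
  proof (rule eq_matI)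
    fix i j assume "i < dim_row (1\<^sub>m n :: complex mat)" "j < dim_col (1\<^sub>m n :: complex mat)"
    then have ij: "i < n" "j < n" by auto
    have "(mat_adjoint W * W) $$ (i, j) = (\<Sum>l<n. cnj (W $$ (l, i)) * W $$ (l, j))"
      using W ij by (subst mult_index_sum[of _ n n _ n]) auto
    also have "\<dots> = c (ws ! i) * c (ws ! j) * (ws ! j \<bullet>c ws ! i)"
      using ij wsc[of i] wsc[of j]
      by (auto simp: W_def scalar_prod_def atLeast0LessThan sum_distrib_left mult_ac cnj_c
          intro!: sum.cong)
    also have "\<dots> = (if i = j then 1 else 0)"
    proof (cases "i = j")
      case False
      then show ?thesis using corthogonalD[OF ws(2), of j i] ij ws(3) by simp
    next
      case True
      define S where "S = (\<Sum>l<n. (cmod (ws ! i $ l))\<^sup>2)"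
      have S: "ws ! i \<bullet>c ws ! i = complex_of_real S"
        using wsc[OF ij(1)] by (simp add: cscalar_prod_self S_def)
      have "S \<noteq> 0" using corthogonalD[OF ws(2), of i i] ij ws(3) S by auto
      moreover have "S \<ge> 0" unfolding S_def by (intro sum_nonneg) auto
      ultimately have "1 / sqrt S * (1 / sqrt S) * S = 1" by (simp add: field_simps)
      then have "complex_of_real (1 / sqrt S * (1 / sqrt S) * S) = 1" by (simp only: of_real_1)
      then have "c (ws ! i) * c (ws ! i) * (ws ! i \<bullet>c ws ! i) = 1"
        unfolding S unfolding c_def S_def[symmetric] of_real_mult .
      then show ?thesis using True by simp
    qed
    finally show "(mat_adjoint W * W) $$ (i, j) = 1\<^sub>m n $$ (i, j)" using ij by simp
  qed (auto simp: W_def)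
  moreover have "col W 0 = c v \<cdot>\<^sub>v v"
    using n v by (intro eq_vecI) (auto simp: W_def hdws)
  ultimately show ?thesis using W unfolding unitary_mat_def by blast
qed

lemma mat_adjoint_four_block_diag:
  fixes A B :: "complex mat"
  assumes A: "A \<in> carrier_mat k k" and B: "B \<in> carrier_mat l l"
  shows "mat_adjoint (four_block_mat A (0\<^sub>m k l) (0\<^sub>m l k) B) =
    four_block_mat (mat_adjoint A) (0\<^sub>m k l) (0\<^sub>m l k) (mat_adjoint B)"
  using assms by (intro eq_matI) auto

lemma mult_four_block_diag:
  fixes A B :: "complex mat"
  assumes "A \<in> carrier_mat k k" "B \<in> carrier_mat l l" "C \<in> carrier_mat k k" "D \<in> carrier_mat l l"
  shows "four_block_mat A (0\<^sub>m k l) (0\<^sub>m l k) B * four_block_mat C (0\<^sub>m k l) (0\<^sub>m l k) D =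
    four_block_mat (A * C) (0\<^sub>m k l) (0\<^sub>m l k) (B * D)"
  using assms by (subst mult_four_block_mat[OF assms(1) _ _ assms(2) assms(3) _ _ assms(4)]) auto

lemma hermitian_unitary_conj:
  fixes H :: "complex mat"
  assumes "H \<in> carrier_mat n n" "mat_adjoint H = H" "W \<in> carrier_mat n n"
  shows "mat_adjoint (mat_adjoint W * H * W) = mat_adjoint W * H * W"
  using assms
  by (simp add: mat_adjoint_mult[of _ n n _ n] assoc_mult_mat[of _ n n _ n _ n])

text \<open>Schur's deflation argument. A unitary \<open>W\<close> whose first column is an eigenvector for the first
listed root \<open>e\<close> turns \<open>H\<close> into a matrix with first column \<open>(e, 0, \<dots>, 0)\<close>. Being Hermitian, that
matrix also has first row \<open>(e, 0, \<dots>, 0)\<close>, so the induction continues with the complementary block,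
whose characteristic polynomial is the product over the remaining roots.

The roots may be listed in any order and appear on the diagonal in that order. This lets
two different spectra both be listed decreasingly, as the trace inequality needs.\<close>

theorem hermitian_diagonalization:
  fixes H :: "complex mat"
  assumes "H \<in> carrier_mat n n" "mat_adjoint H = H" "char_poly H = (\<Prod>e\<leftarrow>es. [:- e, 1:])"
  shows "\<exists>U. unitary_mat n U \<and> mat_adjoint U * H * U = mat_diag n (\<lambda>i. es ! i)"
  using assms
proof (induction es arbitrary: n H)
  case Nil
  then have "n = 0" using degree_monic_char_poly[of H n] by auto
  then show ?case using Nil by (intro exI[of _ "1\<^sub>m 0"]) (auto simp: unitary_mat_def mat_diag_def intro!: eq_matI)
next
  case (Cons e es n H)
  note H = Cons.prems(1) and herm = Cons.prems(2)
  have ev: "eigenvalue H e" 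
    unfolding eigenvalue_root_char_poly[OF H] Cons.prems(3) by simp
  then obtain v where v: "v \<in> carrier_vec n" "v \<noteq> 0\<^sub>v n" "H *\<^sub>v v = e \<cdot>\<^sub>v v"
    using H by (auto simp: eigenvalue_def eigenvector_def)
  then have "n \<noteq> 0" by (auto intro!: eq_vecI)
  then obtain k where n: "n = Suc k" by (cases n) auto
  obtain W c where W: "unitary_mat n W" and col0: "col W 0 = c \<cdot>\<^sub>v v"
    using unitary_completion[OF v(1,2)] by blast
  note WW = unitary_matD[OF W]
  define K where "K = mat_adjoint W * H * W"
  have K: "K \<in> carrier_mat n n" using H WW by (simp add: K_def)
  have hermK: "mat_adjoint K = K" unfolding K_def by (rule hermitian_unitary_conj[OF H herm WW(1)])
  have simK: "similar_mat K H"
    unfolding similar_mat_def similar_mat_wit_def Let_def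
    using H WW K_def K by (intro exI[of _ "mat_adjoint W"] exI[of _ W]) auto
  \<comment> \<open>The eigenvector equation in the coordinates given by the columns of \<open>W\<close>.\<close>
  have K0: "K $$ (i, 0) = (if i = 0 then e else 0)" if i: "i < n" for i
  proof -
    have "col K 0 = (mat_adjoint W * H) *\<^sub>v col W 0"
      unfolding K_def using H WW n by (subst col_mult2[of _ n n _ n]) auto
    also have "\<dots> = mat_adjoint W *\<^sub>v (H *\<^sub>v (c \<cdot>\<^sub>v v))"
      unfolding col0 using H WW v by (subst assoc_mult_mat_vec[of _ n n _ n]) auto
    also have "H *\<^sub>v (c \<cdot>\<^sub>v v) = e \<cdot>\<^sub>v col W 0"
      unfolding col0 using H v by (subst mult_mat_vec[of _ n n]) (auto simp: smult_smult_assoc mult.commute)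
    also have "mat_adjoint W *\<^sub>v (e \<cdot>\<^sub>v col W 0) = e \<cdot>\<^sub>v col (mat_adjoint W * W) 0"
      using WW(1) n col_dim[of W 0] by (subst mult_mat_vec[of _ n n], simp_all add: col_mult2[of _ n n _ n])
    finally have "col K 0 = e \<cdot>\<^sub>v col (1\<^sub>m n) 0" unfolding WW(2) .
    from arg_cong[OF this, of "\<lambda>v. v $ i"] show ?thesis using i n K by auto
  qed
  have K0': "K $$ (0, i) = 0" if i: "i < n" "i \<noteq> 0" for i
  proof -
    have "K $$ (0, i) = mat_adjoint K $$ (0, i)" using hermK by simp
    also have "\<dots> = 0" using K0[OF i(1)] i K n by simp
    finally show ?thesis .
  qed
  define A1 where "A1 = mat 1 1 (\<lambda>_. e)"
  define A3 where "A3 = mat k k (\<lambda>(i, j). K $$ (Suc i, Suc j))"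
  have A1: "A1 \<in> carrier_mat 1 1" and A3: "A3 \<in> carrier_mat k k" by (auto simp: A1_def A3_def)
  have Kb: "K = four_block_mat A1 (0\<^sub>m 1 k) (0\<^sub>m k 1) A3"
    using K0 K0' K n by (intro eq_matI) (auto simp: A1_def A3_def Suc_diff_Suc)
  have "char_poly K = char_poly A1 * char_poly A3"
    unfolding Kb by (rule char_poly_four_block_zeros_col[OF A1 _ A3]) simp
  also have "char_poly A1 = [:- e, 1:]"
    by (simp add: A1_def char_poly_defs det_def sign_def)
  finally have "[:- e, 1:] * char_poly A3 = [:- e, 1:] * (\<Prod>e\<leftarrow>es. [:- e, 1:])"
    using char_poly_similar[OF simK] Cons.prems(3) by simp
  then have cp3: "char_poly A3 = (\<Prod>e\<leftarrow>es. [:- e, 1:])"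
    by (metis mult_cancel_left pCons_eq_0_iff zero_neq_one)
  have herm3: "mat_adjoint A3 = A3"
  proof (rule eq_matI)
    fix i j assume ij: "i < dim_row A3" "j < dim_col A3"
    then have "A3 $$ (i, j) = mat_adjoint K $$ (Suc i, Suc j)" using hermK by (simp add: A3_def)
    then show "mat_adjoint A3 $$ (i, j) = A3 $$ (i, j)" using ij K n by (simp add: A3_def)
  qed (auto simp: A3_def)
  obtain U3 where U3: "unitary_mat k U3" "mat_adjoint U3 * A3 * U3 = mat_diag k (\<lambda>i. es ! i)"
    using Cons.IH[OF A3 herm3 cp3] by blast
  note U3D = unitary_matD[OF U3(1)]
  define V where "V = four_block_mat (1\<^sub>m 1) (0\<^sub>m 1 k) (0\<^sub>m k 1) U3"
  have Va: "mat_adjoint V = four_block_mat (1\<^sub>m 1) (0\<^sub>m 1 k) (0\<^sub>m k 1) (mat_adjoint U3)"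
    unfolding V_def using U3D(1) by (subst mat_adjoint_four_block_diag) auto
  have one: "four_block_mat (1\<^sub>m 1) (0\<^sub>m 1 k) (0\<^sub>m k 1) (1\<^sub>m k) = (1\<^sub>m n :: complex mat)"
    unfolding n by (intro eq_matI) auto
  have V: "unitary_mat n V"
  proof -
    have "mat_adjoint V * V = 1\<^sub>m n"
      unfolding Va unfolding V_def using U3D(1,2) one by (subst mult_four_block_diag) auto
    moreover have "V \<in> carrier_mat n n" unfolding V_def n using U3D(1) by auto
    ultimately show ?thesis by (simp add: unitary_mat_def)
  qed
  note VD = unitary_matD[OF V]
  have "mat_adjoint V * K * V = mat_diag n (\<lambda>i. (e # es) ! i)"
  proof -
    have "mat_adjoint V * K = four_block_mat A1 (0\<^sub>m 1 k) (0\<^sub>m k 1) (mat_adjoint U3 * A3)"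
      unfolding Va Kb using U3D(1) A1 A3 by (subst mult_four_block_diag) auto
    then have "mat_adjoint V * K * V = four_block_mat A1 (0\<^sub>m 1 k) (0\<^sub>m k 1) (mat_adjoint U3 * A3)
        * four_block_mat (1\<^sub>m 1) (0\<^sub>m 1 k) (0\<^sub>m k 1) U3"
      by (simp add: V_def)
    also have "\<dots> = four_block_mat A1 (0\<^sub>m 1 k) (0\<^sub>m k 1) (mat_diag k (\<lambda>i. es ! i))"
      using U3D(1) A1 A3 by (subst mult_four_block_diag) (simp_all flip: U3(2))
    also have "\<dots> = mat_diag n (\<lambda>i. (e # es) ! i)"
      unfolding n by (intro eq_matI) (auto simp: A1_def mat_diag_def nth_Cons split: nat.splits)
    finally show ?thesis .
  qed
  moreover have "mat_adjoint V * K * V = mat_adjoint (W * V) * H * (W * V)"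
    unfolding K_def using VD(1) WW(1) H
    by (simp add: mat_adjoint_mult[of _ n n _ n] assoc_mult_mat[of _ n n _ n _ n])
  ultimately show ?case using unitary_mat_mult[OF W V] by metis
qed

section \<open>Trace and Frobenius norm\<close>

definition mat_trace :: "complex mat \<Rightarrow> complex" where
  "mat_trace A = (\<Sum>i<dim_row A. A $$ (i, i))"

text \<open>A trace of a product is a double sum over all entries; cyclicity of the trace and the formula for
the Frobenius norm are both read off from this.\<close>

lemma mat_trace_mult:
  assumes "A \<in> carrier_mat m n" "B \<in> carrier_mat n m"
  shows "mat_trace (A * B) = (\<Sum>i<m. \<Sum>j<n. A $$ (i, j) * B $$ (j, i))"
proof -
  have "mat_trace (A * B) = (\<Sum>i<m. (A * B) $$ (i, i))"
    using assms by (simp add: mat_trace_def)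
  also have "\<dots> = (\<Sum>i<m. \<Sum>j<n. A $$ (i, j) * B $$ (j, i))"
    by (rule sum.cong) (auto simp: mult_index_sum[OF assms] simp del: index_mult_mat(1))
  finally show ?thesis .
qed

lemma mat_trace_comm:
  assumes "A \<in> carrier_mat m n" "B \<in> carrier_mat n m"
  shows "mat_trace (A * B) = mat_trace (B * A)"
  unfolding mat_trace_mult[OF assms] mat_trace_mult[OF assms(2,1)]
  by (subst sum.swap) (simp add: mult.commute)

lemma mat_trace_add:
  assumes "A \<in> carrier_mat n n" "B \<in> carrier_mat n n"
  shows "mat_trace (A + B) = mat_trace A + mat_trace B"
proof -
  have "mat_trace (A + B) = (\<Sum>i<n. A $$ (i, i) + B $$ (i, i))"
    unfolding mat_trace_def using assms by (intro sum.cong) auto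
  also have "\<dots> = mat_trace A + mat_trace B"
    unfolding sum.distrib mat_trace_def carrier_matD(1)[OF assms(1)] carrier_matD(1)[OF assms(2)] ..
  finally show ?thesis .
qed

lemma frob_norm_sq_trace:
  "complex_of_real ((frob_norm A)\<^sup>2) = mat_trace (mat_adjoint A * A)"
proof -
  define m n where "m = dim_row A" and "n = dim_col A"
  have A: "A \<in> carrier_mat m n" unfolding m_def n_def by (rule carrier_matI) (rule refl)+
  have "(frob_norm A)\<^sup>2 = (\<Sum>i<m. \<Sum>j<n. (cmod (A $$ (i, j)))\<^sup>2)"
    unfolding frob_norm_def m_def n_def by (intro real_sqrt_pow2 sum_nonneg) auto
  also have "complex_of_real \<dots> = (\<Sum>i<m. \<Sum>j<n. cnj (A $$ (i, j)) * A $$ (i, j))"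
    by (simp add: complex_norm_square mult.commute del: of_real_power)
  also have "\<dots> = (\<Sum>j<n. \<Sum>i<m. cnj (A $$ (i, j)) * A $$ (i, j))"
    by (rule sum.swap)
  also have "\<dots> = mat_trace (mat_adjoint A * A)"
    unfolding mat_trace_mult[OF mat_adjoint_carrier[OF A] A] using A
    by (intro sum.cong) auto
  finally show ?thesis .
qed

lemma frob_norm_nonneg: "0 \<le> frob_norm A"
  unfolding frob_norm_def by (intro real_sqrt_ge_zero sum_nonneg) auto

section \<open>Positive semidefinite matrices and their square roots\<close>

lemma psd_mat_gram:
  assumes A: "A \<in> carrier_mat m n"
  shows "psd_mat n (mat_adjoint A * A)"
  unfolding psd_mat_def
proof (intro conjI ballI)
  note Aa = mat_adjoint_carrier[OF A]
  show "mat_adjoint A * A \<in> carrier_mat n n" by (rule mult_carrier_mat[OF Aa A])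
  show "mat_adjoint (mat_adjoint A * A) = mat_adjoint A * A"
    unfolding mat_adjoint_mult[OF Aa A] by simp
  fix v :: "complex vec" assume v: "v \<in> carrier_vec n"
  have "(mat_adjoint A * A *\<^sub>v v) \<bullet>c v = (A *\<^sub>v v) \<bullet>c (A *\<^sub>v v)"
    using adjoint_cscalar_prod[OF Aa mult_mat_vec_carrier[OF A v] v] A Aa v
    by (subst assoc_mult_mat_vec[OF Aa A v]) simp
  then show "0 \<le> Re ((mat_adjoint A * A *\<^sub>v v) \<bullet>c v)"
    unfolding cscalar_prod_self by (auto intro!: sum_nonneg)
qed

lemma psd_mat_unitary_conj:
  assumes P: "psd_mat n P" and U: "U \<in> carrier_mat n n"
  shows "psd_mat n (mat_adjoint U * P * U)"
  unfolding psd_mat_def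
proof (intro conjI ballI)
  note Ua = mat_adjoint_carrier[OF U]
  have Pc: "P \<in> carrier_mat n n" and Ph: "mat_adjoint P = P" using P by (auto simp: psd_mat_def)
  show "mat_adjoint U * P * U \<in> carrier_mat n n" using U Ua Pc by simp
  show "mat_adjoint (mat_adjoint U * P * U) = mat_adjoint U * P * U"
    by (rule hermitian_unitary_conj[OF Pc Ph U])
  fix v :: "complex vec" assume v: "v \<in> carrier_vec n"
  note Uv = mult_mat_vec_carrier[OF U v]
  have "mat_adjoint U * P * U *\<^sub>v v = mat_adjoint U *\<^sub>v (P *\<^sub>v (U *\<^sub>v v))"
    using Pc U Ua v Uv
    by (simp add: assoc_mult_mat_vec[of _ n n _ n])
  then have "(mat_adjoint U * P * U *\<^sub>v v) \<bullet>c v = (P *\<^sub>v (U *\<^sub>v v)) \<bullet>c (U *\<^sub>v v)"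
    using adjoint_cscalar_prod[OF Ua mult_mat_vec_carrier[OF Pc Uv] v] by simp
  then show "0 \<le> Re ((mat_adjoint U * P * U *\<^sub>v v) \<bullet>c v)"
    using P Uv by (auto simp: psd_mat_def)
qed

lemma hermitian_diag_real:
  assumes "P \<in> carrier_mat n n" "mat_adjoint P = P" "i < n"
  shows "P $$ (i, i) = complex_of_real (Re (P $$ (i, i)))"
proof -
  have "cnj (P $$ (i, i)) = P $$ (i, i)"
    using mat_adjoint_index[of i P i] assms by simp
  then show ?thesis by (simp add: complex_eq_iff)
qed

lemma psd_mat_diag:
  assumes "psd_mat n P" and i: "i < n"
  shows "P $$ (i, i) = complex_of_real (Re (P $$ (i, i)))" "0 \<le> Re (P $$ (i, i))"
proof -
  have P: "P \<in> carrier_mat n n" "mat_adjoint P = P" using assms by (auto simp: psd_mat_def)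
  show "P $$ (i, i) = complex_of_real (Re (P $$ (i, i)))" by (rule hermitian_diag_real[OF P i])
  have "(P *\<^sub>v unit_vec n i) \<bullet>c unit_vec n i = P $$ (i, i)"
  proof -
    have c: "conjugate (unit_vec n i) = (unit_vec n i :: complex vec)"
      by (rule eq_vecI) (auto simp: unit_vec_def)
    show ?thesis unfolding c using P i
      by (subst scalar_prod_right_unit) auto
  qed
  then show "0 \<le> Re (P $$ (i, i))"
    using assms(1) unit_vec_carrier[of n i] unfolding psd_mat_def by metis
qed

lemma unitary_conj_inverse:
  assumes U: "unitary_mat n U" and P: "P \<in> carrier_mat n n"
  shows "U * (mat_adjoint U * P * U) * mat_adjoint U = P"
proof -
  note UD = unitary_matD[OF U]
  note Ua = mat_adjoint_carrier[OF UD(1)]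
  have "U * (mat_adjoint U * P * U) * mat_adjoint U = (U * mat_adjoint U) * P * (U * mat_adjoint U)"
    using UD(1) Ua P by (simp add: assoc_mult_mat[of _ n n _ n _ n])
  then show ?thesis unfolding UD(3) using P by simp
qed

lemma length_char_poly_factors:
  fixes H :: "complex mat"
  assumes H: "H \<in> carrier_mat n n" and cp: "char_poly H = (\<Prod>e\<leftarrow>es. [:- e, 1:])"
  shows "length es = n"
  using degree_monic_char_poly[OF H] degree_linear_factors[of uminus es] unfolding cp by simp

text \<open>After conjugation with the unitary matrix of the spectral theorem the matrix is still positive
semidefinite, so its diagonal entries, which are the roots, are real and nonnegative.\<close>

lemma psd_diagonalization:
  assumes P: "psd_mat n P" and cp: "char_poly P = (\<Prod>e\<leftarrow>es. [:- e, 1:])"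
  shows "\<forall>e \<in> set es. e = complex_of_real (Re e) \<and> 0 \<le> Re e"
    and "\<exists>U. unitary_mat n U \<and> P = U * mat_diag n (\<lambda>i. es ! i) * mat_adjoint U"
proof -
  have Pc: "P \<in> carrier_mat n n" and Ph: "mat_adjoint P = P" using P by (auto simp: psd_mat_def)
  obtain U where U: "unitary_mat n U" and D: "mat_adjoint U * P * U = mat_diag n (\<lambda>i. es ! i)"
    using hermitian_diagonalization[OF Pc Ph cp] by blast
  have psd: "psd_mat n (mat_diag n (\<lambda>i. es ! i))"
    using psd_mat_unitary_conj[OF P unitary_matD(1)[OF U]] unfolding D .
  show "\<forall>e \<in> set es. e = complex_of_real (Re e) \<and> 0 \<le> Re e"
  proof
    fix e assume "e \<in> set es"
    then obtain i where i: "i < n" "e = es ! i"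
      using length_char_poly_factors[OF Pc cp] by (auto simp: in_set_conv_nth)
    then show "e = complex_of_real (Re e) \<and> 0 \<le> Re e"
      using psd_mat_diag[OF psd i(1)] by (simp add: mat_diag_def)
  qed
  show "\<exists>U. unitary_mat n U \<and> P = U * mat_diag n (\<lambda>i. es ! i) * mat_adjoint U"
    using unitary_conj_inverse[OF U Pc] U unfolding D by metis
qed

text \<open>With nonnegative \<open>f\<close> the matrix \<open>U diag(f) U\<^sup>*\<close> is the Gram matrix of \<open>diag(\<surd>f) U\<^sup>*\<close>.\<close>

lemma psd_mat_unitary_diag:
  assumes U: "unitary_mat n U" and f: "\<And>i. i < n \<Longrightarrow> 0 \<le> f i"
  shows "psd_mat n (U * mat_diag n (\<lambda>i. complex_of_real (f i)) * mat_adjoint U)"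
proof -
  note UD = unitary_matD[OF U]
  define S where "S = mat_diag n (\<lambda>i. complex_of_real (sqrt (f i)))"
  have S: "S \<in> carrier_mat n n" by (simp add: S_def)
  have Sa: "mat_adjoint S = S" unfolding S_def by (rule mat_adjoint_mat_diag_real)
  have SS: "S * S = mat_diag n (\<lambda>i. complex_of_real (f i))"
    unfolding S_def mat_diag_diag using f by (intro eq_matI) (auto simp: mat_diag_def simp flip: of_real_mult)
  have "mat_adjoint (S * mat_adjoint U) * (S * mat_adjoint U) = U * S * (S * mat_adjoint U)"
    using mat_adjoint_mult[OF S mat_adjoint_carrier[OF UD(1)]] Sa by simp
  also have "\<dots> = U * (S * S) * mat_adjoint U"
    using S UD(1) by (simp add: assoc_mult_mat[of _ n n _ n _ n])
  finally show ?thesis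
    using psd_mat_gram[of "S * mat_adjoint U" n n] S UD(1) SS by simp
qed

lemma unitary_diag_mult:
  assumes U: "unitary_mat n U"
  shows "U * mat_diag n f * mat_adjoint U * (U * mat_diag n g * mat_adjoint U) =
    U * mat_diag n (\<lambda>i. f i * g i) * mat_adjoint U"
proof -
  note UD = unitary_matD[OF U]
  note Ua = mat_adjoint_carrier[OF UD(1)]
  have "U * mat_diag n f * mat_adjoint U * (U * mat_diag n g * mat_adjoint U) =
     U * mat_diag n f * ((mat_adjoint U * U) * (mat_diag n g * mat_adjoint U))"
    using UD(1) Ua by (simp add: assoc_mult_mat[of _ n n _ n _ n])
  also have "\<dots> = U * (mat_diag n f * mat_diag n g) * mat_adjoint U"
    unfolding UD(2) using UD(1) Ua 
    by (simp add: assoc_mult_mat[of _ n n _ n _ n] left_mult_one_mat[of _ n n] del: mat_diag_diag)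
  finally show ?thesis by simp
qed

lemma psd_sqrt_exists:
  assumes P: "psd_mat n P"
  shows "\<exists>Q. psd_mat n Q \<and> Q * Q = P"
proof -
  have Pc: "P \<in> carrier_mat n n" using P by (auto simp: psd_mat_def)
  obtain es where cp: "char_poly P = (\<Prod>e\<leftarrow>es. [:- e, 1:])"
    using char_poly_factorized[OF Pc] by blast
  note len = length_char_poly_factors[OF Pc cp]
  note nn = psd_diagonalization(1)[OF P cp]
  obtain U where U: "unitary_mat n U" and PU: "P = U * mat_diag n (\<lambda>i. es ! i) * mat_adjoint U"
    using psd_diagonalization(2)[OF P cp] by blast
  have ev: "es ! i = complex_of_real (Re (es ! i))" "0 \<le> Re (es ! i)" if "i < n" for i
    using nn len that by (auto simp: all_set_conv_all_nth)
  define s where "s i = sqrt (Re (es ! i))" for i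
  define Q where "Q = U * mat_diag n (\<lambda>i. complex_of_real (s i)) * mat_adjoint U"
  have "psd_mat n Q" unfolding Q_def
    by (rule psd_mat_unitary_diag[OF U]) (use ev in \<open>auto simp: s_def\<close>)
  moreover have "mat_diag n (\<lambda>i. complex_of_real (s i) * complex_of_real (s i)) = mat_diag n (\<lambda>i. es ! i)"
    by (intro eq_matI) (use ev in \<open>auto simp: mat_diag_def s_def simp flip: of_real_mult\<close>)
  then have "Q * Q = P" unfolding Q_def unitary_diag_mult[OF U] PU by simp
  ultimately show ?thesis by blast
qed

text \<open>Diagonalize the Hermitian difference \<open>Q - R\<close>, so that \<open>Q' = R' + diag(e\<^sub>1, \<dots>, e\<^sub>n)\<close> in the new
coordinates. Comparing the \<open>i\<close>-th diagonal entries of \<open>Q'\<^sup>2 = R'\<^sup>2\<close> gives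
\<open>e\<^sub>i (2 R'\<^sub>i\<^sub>i + e\<^sub>i) = 0\<close>, that is \<open>e\<^sub>i (R'\<^sub>i\<^sub>i + Q'\<^sub>i\<^sub>i) = 0\<close>. If the second factor vanishes, both of its
nonnegative summands do, and then so does their difference \<open>e\<^sub>i\<close>.\<close>

lemma psd_sqrt_unique:
  assumes Q: "psd_mat n Q" and R: "psd_mat n R" and QR: "Q * Q = R * R"
  shows "Q = R"
proof -
  have Qc: "Q \<in> carrier_mat n n" and Qh: "mat_adjoint Q = Q"
    and Rc: "R \<in> carrier_mat n n" and Rh: "mat_adjoint R = R" using Q R by (auto simp: psd_mat_def)
  define D where "D = Q - R"
  have Dc: "D \<in> carrier_mat n n" using Qc Rc unfolding D_def by (intro minus_carrier_mat)
  have Dh: "mat_adjoint D = D" unfolding D_def mat_adjoint_diff[OF Qc Rc] Qh Rh ..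
  obtain es where cp: "char_poly D = (\<Prod>e\<leftarrow>es. [:- e, 1:])"
    using char_poly_factorized[OF Dc] by blast
  obtain U where U: "unitary_mat n U" and DU: "mat_adjoint U * D * U = mat_diag n (\<lambda>i. es ! i)"
    using hermitian_diagonalization[OF Dc Dh cp] by blast
  note UD = unitary_matD[OF U]
  note Ua = mat_adjoint_carrier[OF UD(1)]
  define Q' R' where "Q' = mat_adjoint U * Q * U" and "R' = mat_adjoint U * R * U"
  have Q': "psd_mat n Q'" "Q' \<in> carrier_mat n n" and R': "psd_mat n R'" "R' \<in> carrier_mat n n"
    using psd_mat_unitary_conj[OF Q UD(1)] psd_mat_unitary_conj[OF R UD(1)]
    by (auto simp: Q'_def R'_def psd_mat_def)
  have conj_sq: "mat_adjoint U * X * U * (mat_adjoint U * X * U) = mat_adjoint U * (X * X) * U"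
    if X: "X \<in> carrier_mat n n" for X
  proof -
    have "mat_adjoint U * X * U * (mat_adjoint U * X * U) = mat_adjoint U * X * ((U * mat_adjoint U) * (X * U))"
      using UD(1) Ua X by (simp add: assoc_mult_mat[of _ n n _ n _ n])
    then show ?thesis unfolding UD(3) using UD(1) Ua X
      by (simp add: assoc_mult_mat[of _ n n _ n _ n])
  qed
  have sq: "Q' * Q' = R' * R'"
    unfolding Q'_def R'_def conj_sq[OF Qc] conj_sq[OF Rc] QR ..
  have "mat_adjoint U * D * U = Q' - R'"
    unfolding D_def Q'_def R'_def using UD(1) Ua Qc Rc
    by (simp add: mult_minus_distrib_mat[of _ n n _ n] minus_mult_distrib_mat[of _ n n _ _ n])
  then have diff: "Q' $$ (i, j) = R' $$ (i, j) + (if i = j then es ! i else 0)" if "i < n" "j < n" for i j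
  proof -
    have "(Q' - R') $$ (i, j) = mat_diag n (\<lambda>i. es ! i) $$ (i, j)"
      using DU \<open>mat_adjoint U * D * U = Q' - R'\<close> by simp
    then show ?thesis using that Q'(2) R'(2) by (simp add: mat_diag_def diff_eq_eq split: if_splits)
  qed
  have es0: "es ! i = 0" if i: "i < n" for i
  proof -
    define e where "e = es ! i"
    have "(Q' * Q') $$ (i, i) = (\<Sum>l<n. Q' $$ (i, l) * Q' $$ (l, i))"
      by (rule mult_index_sum[OF Q'(2) Q'(2) i i])
    also have "\<dots> = (\<Sum>l<n. R' $$ (i, l) * R' $$ (l, i) + (if l = i then e * (2 * R' $$ (i, i) + e) else 0))"
      using i by (intro sum.cong) (auto simp: diff e_def algebra_simps)
    also have "\<dots> = (R' * R') $$ (i, i) + e * (2 * R' $$ (i, i) + e)"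
      unfolding mult_index_sum[OF R'(2) R'(2) i i] sum.distrib using i by simp
    finally have "e * (2 * R' $$ (i, i) + e) = 0" unfolding sq by simp
    moreover have "2 * R' $$ (i, i) + e = R' $$ (i, i) + Q' $$ (i, i)" using diff[OF i i] e_def by simp
    ultimately have "e = 0 \<or> R' $$ (i, i) + Q' $$ (i, i) = 0" by auto
    then show "es ! i = 0"
    proof
      assume "R' $$ (i, i) + Q' $$ (i, i) = 0"
      then have "Re (R' $$ (i, i)) + Re (Q' $$ (i, i)) = 0" by (metis plus_complex.sel(1) zero_complex.sel(1))
      then have "Re (R' $$ (i, i)) = 0" "Re (Q' $$ (i, i)) = 0"
        using psd_mat_diag(2)[OF Q'(1) i] psd_mat_diag(2)[OF R'(1) i] by linarith+
      then have "R' $$ (i, i) = 0" "Q' $$ (i, i) = 0"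
        using psd_mat_diag(1)[OF Q'(1) i] psd_mat_diag(1)[OF R'(1) i] by simp_all
      then show ?thesis using diff[OF i i] by simp
    qed (simp add: e_def)
  qed
  have "Q' = R'"
    using Q'(2) R'(2) by (intro eq_matI) (auto simp: diff es0)
  then show ?thesis
    using unitary_conj_inverse[OF U Qc] unitary_conj_inverse[OF U Rc] unfolding Q'_def R'_def by metis
qed

text \<open>Existence and uniqueness of the square root give the definite description in \<open>mat_sqrt\<close> its
value.\<close>

lemma mat_abs_square:
  assumes A: "A \<in> carrier_mat m n"
  shows "mat_abs A ^\<^sub>m 2 = mat_adjoint A * A"
proof -
  note P = psd_mat_gram[OF A]
  have d: "dim_row (mat_adjoint A * A) = n" using A by simp
  obtain Q where Q: "psd_mat n Q" "Q * Q = mat_adjoint A * A" using psd_sqrt_exists[OF P] by blast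
  have "mat_abs A = Q" unfolding mat_abs_def mat_sqrt_def d
  proof (rule the_equality)
    show "psd_mat n Q \<and> Q * Q = mat_adjoint A * A" using Q ..
    fix R assume "psd_mat n R \<and> R * R = mat_adjoint A * A"
    then show "R = Q" using Q by (metis psd_sqrt_unique)
  qed
  moreover have "Q \<in> carrier_mat n n" using Q by (simp add: psd_mat_def)
  ultimately show ?thesis using Q by (simp add: numeral_2_eq_2)
qed

section \<open>Rearrangement against doubly substochastic weights\<close>

lemma substochastic_corner_le:
  fixes w :: "nat \<Rightarrow> nat \<Rightarrow> real"
  assumes w: "\<And>i j. i < n \<Longrightarrow> j < n \<Longrightarrow> 0 \<le> w i j"
    and row: "\<And>i. i < n \<Longrightarrow> (\<Sum>j<n. w i j) \<le> 1"
  shows "(\<Sum>i<n. \<Sum>j<n. of_bool (i \<le> k) * of_bool (j \<le> l) * w i j) \<le> (\<Sum>i<n. of_bool (i \<le> k))"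
proof (rule sum_mono)
  fix i assume i: "i \<in> {..<n}"
  have "(\<Sum>j<n. of_bool (i \<le> k) * of_bool (j \<le> l) * w i j) \<le> (\<Sum>j<n. of_bool (i \<le> k) * w i j)"
    by (rule sum_mono) (use i w in \<open>auto simp: of_bool_def\<close>)
  also have "\<dots> \<le> of_bool (i \<le> k)"
    using row[of i] i unfolding sum_distrib_left[symmetric] by (cases "i \<le> k") auto
  finally show "(\<Sum>j<n. of_bool (i \<le> k) * of_bool (j \<le> l) * w i j) \<le> of_bool (i \<le> k)" .
qed

text \<open>A sequence vanishing at \<open>n\<close> is a combination of the indicator functions of \<open>{..k}\<close> whose
coefficients are its decrements; for a decreasing sequence they are nonnegative.\<close>

lemma layer_decomposition:
  fixes a :: "nat \<Rightarrow> real"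
  assumes "a n = 0" "i < n"
  shows "a i = (\<Sum>k<n. (a k - a (Suc k)) * of_bool (i \<le> k))"
proof -
  have "(\<Sum>k<n. (a k - a (Suc k)) * of_bool (i \<le> k)) = (\<Sum>k\<in>{i..<n}. a k - a (Suc k))"
    by (rule sum.mono_neutral_cong_right) (use assms in auto)
  also have "\<dots> = a i - a n"
    using assms sum_Suc_diff'[of i n "\<lambda>k. - a k"] by simp
  finally show ?thesis using assms by simp
qed

text \<open>The layer decomposition in both arguments reduces a bilinear sum against \<open>w\<close> to the upper left
corner sums of \<open>w\<close>.\<close>

lemma bilinear_layers:
  fixes a b :: "nat \<Rightarrow> real" and w :: "nat \<Rightarrow> nat \<Rightarrow> real"
  assumes "a n = 0" "b n = 0"
  shows "(\<Sum>i<n. \<Sum>j<n. a i * b j * w i j) =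
    (\<Sum>k<n. \<Sum>l<n. (a k - a (Suc k)) * (b l - b (Suc l)) *
       (\<Sum>i<n. \<Sum>j<n. of_bool (i \<le> k) * of_bool (j \<le> l) * w i j))"
proof -
  define \<alpha> \<beta> where "\<alpha> k = a k - a (Suc k)" and "\<beta> l = b l - b (Suc l)" for k l
  have "(\<Sum>i<n. \<Sum>j<n. a i * b j * w i j) =
    (\<Sum>i<n. \<Sum>j<n. (\<Sum>k<n. \<alpha> k * of_bool (i \<le> k)) * (\<Sum>l<n. \<beta> l * of_bool (j \<le> l)) * w i j)"
    unfolding \<alpha>_def \<beta>_def
    by (intro sum.cong refl arg_cong2[where f = "(*)"] layer_decomposition assms) simp_all
  also have "\<dots> = (\<Sum>i<n. \<Sum>j<n. \<Sum>k<n. \<Sum>l<n. \<alpha> k * \<beta> l * (of_bool (i \<le> k) * of_bool (j \<le> l) * w i j))"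
    unfolding sum_product unfolding sum_distrib_right by (intro sum.cong refl) (simp only: mult_ac)
  also have "\<dots> = (\<Sum>i<n. \<Sum>k<n. \<Sum>l<n. \<Sum>j<n. \<alpha> k * \<beta> l * (of_bool (i \<le> k) * of_bool (j \<le> l) * w i j))"
    by (rule sum.cong[OF refl], subst sum.swap, rule sum.cong[OF refl], subst sum.swap, rule refl)
  also have "\<dots> = (\<Sum>k<n. \<Sum>l<n. \<Sum>i<n. \<Sum>j<n. \<alpha> k * \<beta> l * (of_bool (i \<le> k) * of_bool (j \<le> l) * w i j))"
    by (subst sum.swap, rule sum.cong[OF refl], subst sum.swap, rule refl)
  finally show ?thesis unfolding \<alpha>_def \<beta>_def by (simp only: sum_distrib_left)
qed

text \<open>After splitting \<open>a\<close> and \<open>b\<close> into layers with nonnegative coefficients, it suffices to compare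
corner sums. The upper left corner of a doubly substochastic matrix has total weight at most the
number of its rows and at most the number of its columns, and the identity matrix attains the
minimum of the two. This replaces the usual appeal to permutation matrices as extreme points.\<close>

theorem doubly_substochastic_rearrangement:
  fixes a b :: "nat \<Rightarrow> real" and w :: "nat \<Rightarrow> nat \<Rightarrow> real"
  assumes a: "antimono a" "a n = 0" and b: "antimono b" "b n = 0"
    and w: "\<And>i j. i < n \<Longrightarrow> j < n \<Longrightarrow> 0 \<le> w i j"
    and row: "\<And>i. i < n \<Longrightarrow> (\<Sum>j<n. w i j) \<le> 1"
    and col: "\<And>j. j < n \<Longrightarrow> (\<Sum>i<n. w i j) \<le> 1"
  shows "(\<Sum>i<n. \<Sum>j<n. a i * b j * w i j) \<le> (\<Sum>i<n. a i * b i)"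
proof -
  define corner where "corner v k l = (\<Sum>i<n. \<Sum>j<n. of_bool (i \<le> k) * of_bool (j \<le> l) * v i j)"
    for v :: "nat \<Rightarrow> nat \<Rightarrow> real" and k l :: nat
  define \<delta> :: "nat \<Rightarrow> nat \<Rightarrow> real" where "\<delta> i j = of_bool (i = j)" for i j
  have corner_\<delta>: "corner \<delta> k l = (\<Sum>i<n. of_bool (i \<le> min k l))" for k l
  proof -
    have "corner \<delta> k l = (\<Sum>i<n. \<Sum>j<n. if j = i then of_bool (i \<le> min k l) else 0)"
      unfolding corner_def \<delta>_def by (intro sum.cong refl) auto
    then show ?thesis by simp
  qed
  have corner_w: "corner w k l \<le> corner \<delta> k l" for k l
  proof (cases "k \<le> l")
    case True
    then show ?thesis unfolding corner_\<delta> unfolding corner_def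
      using substochastic_corner_le[of n w k l] w row by (simp add: min_def)
  next
    case False
    \<comment> \<open>With fewer columns than rows in the corner, the row bound is applied to the transposed weights.\<close>
    have "corner w k l = (\<Sum>i<n. \<Sum>j<n. of_bool (i \<le> l) * of_bool (j \<le> k) * w j i)"
      unfolding corner_def by (subst sum.swap) (simp only: mult_ac)
    also have "\<dots> \<le> (\<Sum>i<n. of_bool (i \<le> l))"
      by (rule substochastic_corner_le) (use w col in auto)
    finally show ?thesis using False unfolding corner_\<delta> by (simp add: min_def)
  qed
  have "(\<Sum>i<n. \<Sum>j<n. a i * b j * w i j) = (\<Sum>k<n. \<Sum>l<n. (a k - a (Suc k)) * (b l - b (Suc l)) * corner w k l)"
    unfolding corner_def by (rule bilinear_layers[of a n b, OF a(2) b(2)])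
  also have "\<dots> \<le> (\<Sum>k<n. \<Sum>l<n. (a k - a (Suc k)) * (b l - b (Suc l)) * corner \<delta> k l)"
    using a(1) b(1) by (intro sum_mono mult_left_mono corner_w mult_nonneg_nonneg) (auto simp: antimono_def)
  also have "\<dots> = (\<Sum>i<n. \<Sum>j<n. a i * b j * \<delta> i j)"
    unfolding corner_def by (rule bilinear_layers[of a n b, OF a(2) b(2), symmetric])
  also have "\<dots> = (\<Sum>i<n. a i * b i)"
    by (simp add: \<delta>_def of_bool_def if_distrib sum.delta cong: if_cong)
  finally show ?thesis .
qed

section \<open>The von Neumann trace inequality\<close>

lemma mat_trace_unitary_diag:
  assumes U: "unitary_mat n U"
  shows "mat_trace (U * mat_diag n f * mat_adjoint U) = (\<Sum>i<n. f i)"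
proof -
  note UD = unitary_matD[OF U]
  have "mat_trace (U * mat_diag n f * mat_adjoint U) = mat_trace (mat_adjoint U * (U * mat_diag n f))"
    by (rule mat_trace_comm[of _ n n]) (use UD(1) in simp_all)
  also have "mat_adjoint U * (U * mat_diag n f) = (mat_adjoint U * U) * mat_diag n f"
    using UD(1) by (simp add: assoc_mult_mat[of _ n n _ n _ n])
  also have "\<dots> = mat_diag n f"
    unfolding UD(2) by (simp add: left_mult_one_mat[of _ n n])
  finally show ?thesis by (simp add: mat_trace_def mat_diag_def)
qed

lemma unitary_mat_row_col_norm:
  assumes W: "unitary_mat n W" and i: "i < n"
  shows "(\<Sum>j<n. (cmod (W $$ (i, j)))\<^sup>2) = 1" "(\<Sum>j<n. (cmod (W $$ (j, i)))\<^sup>2) = 1"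
proof -
  have col: "(\<Sum>j<n. (cmod (V $$ (j, i)))\<^sup>2) = 1" if V: "unitary_mat n V" for V
  proof -
    note VD = unitary_matD[OF V]
    have "complex_of_real (\<Sum>j<n. (cmod (V $$ (j, i)))\<^sup>2) = (\<Sum>j<n. mat_adjoint V $$ (i, j) * V $$ (j, i))"
      unfolding of_real_sum by (rule sum.cong) (use VD(1) i in \<open>auto simp: complex_norm_square mult.commute simp del: of_real_power\<close>)
    also have "\<dots> = (mat_adjoint V * V) $$ (i, i)"
      by (rule mult_index_sum[OF mat_adjoint_carrier[OF VD(1)] VD(1) i i, symmetric])
    also have "\<dots> = 1" unfolding VD(2) using i by simp
    finally show ?thesis by (simp only: of_real_eq_1_iff)
  qed
  show "(\<Sum>j<n. (cmod (W $$ (j, i)))\<^sup>2) = 1" by (rule col[OF W])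
  have "(\<Sum>j<n. (cmod (W $$ (i, j)))\<^sup>2) = (\<Sum>j<n. (cmod (mat_adjoint W $$ (j, i)))\<^sup>2)"
    using unitary_matD(1)[OF W] i by (intro sum.cong) auto
  then show "(\<Sum>j<n. (cmod (W $$ (i, j)))\<^sup>2) = 1" using col[OF unitary_mat_adjoint[OF W]] by simp
qed

text \<open>The trace of a product of two Hermitian matrices pairs the two spectra with the squared moduli
of the entries of \<open>U\<^sup>* V\<close>, the unitary matrix relating the two eigenbases.\<close>

lemma mat_trace_two_spectral:
  fixes a b :: "nat \<Rightarrow> real"
  assumes U: "unitary_mat n U" and V: "unitary_mat n V"
  defines "W \<equiv> mat_adjoint U * V"
  shows "mat_trace (U * mat_diag n (\<lambda>i. complex_of_real (a i)) * mat_adjoint U *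
      (V * mat_diag n (\<lambda>i. complex_of_real (b i)) * mat_adjoint V)) =
    complex_of_real (\<Sum>i<n. \<Sum>j<n. a i * b j * (cmod (W $$ (i, j)))\<^sup>2)"
proof -
  note UD = unitary_matD[OF U] and VD = unitary_matD[OF V]
  note Ua = mat_adjoint_carrier[OF UD(1)] and Va = mat_adjoint_carrier[OF VD(1)]
  define Da Db where "Da = mat_diag n (\<lambda>i. complex_of_real (a i))" and "Db = mat_diag n (\<lambda>i. complex_of_real (b i))"
  have D: "Da \<in> carrier_mat n n" "Db \<in> carrier_mat n n" by (simp_all add: Da_def Db_def)
  have W: "W \<in> carrier_mat n n" using Ua VD(1) by (simp add: W_def)
  \<comment> \<open>Moving \<open>U\<close> around the trace leaves \<open>tr (diag(a) W diag(b) W\<^sup>*)\<close>.\<close>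
  have "mat_trace (U * Da * mat_adjoint U * (V * Db * mat_adjoint V)) = mat_trace (U * (Da * W * Db * mat_adjoint V))"
    unfolding W_def using UD(1) VD(1) Ua Va D by (simp add: assoc_mult_mat[of _ n n _ n _ n])
  also have "\<dots> = mat_trace (Da * W * Db * mat_adjoint V * U)"
    by (rule mat_trace_comm[of _ n n]) (use UD(1) Va D W in simp_all)
  also have "Da * W * Db * mat_adjoint V * U = Da * W * (Db * mat_adjoint W)"
    unfolding W_def mat_adjoint_mult[OF Ua VD(1)] using UD(1) VD(1) Ua Va D
    by (simp add: assoc_mult_mat[of _ n n _ n _ n])
  also have "mat_trace (Da * W * (Db * mat_adjoint W)) =
      (\<Sum>i<n. \<Sum>j<n. (Da * W) $$ (i, j) * (Db * mat_adjoint W) $$ (j, i))"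
    by (rule mat_trace_mult) (use D W in simp_all)
  also have "\<dots> = (\<Sum>i<n. \<Sum>j<n. complex_of_real (a i * b j * (cmod (W $$ (i, j)))\<^sup>2))"
    unfolding Da_def Db_def mat_diag_mult_left[OF W] mat_diag_mult_left[OF mat_adjoint_carrier[OF W]]
    using W by (intro sum.cong refl) (auto simp: complex_norm_square mult_ac simp del: of_real_power)
  finally show ?thesis unfolding Da_def Db_def of_real_sum .
qed

text \<open>Rows and columns of a unitary matrix have norm one, so the squared moduli of its entries form a
doubly stochastic matrix, and the rearrangement inequality applies.\<close>

theorem von_neumann_trace_inequality:
  fixes a b :: "nat \<Rightarrow> real"
  assumes U: "unitary_mat n U" and V: "unitary_mat n V"
    and a: "antimono a" "a n = 0" and b: "antimono b" "b n = 0"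
  shows "Re (mat_trace (U * mat_diag n (\<lambda>i. complex_of_real (a i)) * mat_adjoint U *
      (V * mat_diag n (\<lambda>i. complex_of_real (b i)) * mat_adjoint V))) \<le> (\<Sum>i<n. a i * b i)"
proof -
  define W where "W = mat_adjoint U * V"
  have W: "unitary_mat n W" unfolding W_def by (rule unitary_mat_mult[OF unitary_mat_adjoint[OF U] V])
  show ?thesis
    unfolding mat_trace_two_spectral[OF U V] W_def[symmetric] Re_complex_of_real
    by (rule doubly_substochastic_rearrangement[OF a b])
      (simp_all add: unitary_mat_row_col_norm[OF W])
qed

section \<open>Singular values as a spectral decomposition\<close>

text \<open>The spectrum of \<open>A\<^sup>* A\<close> in decreasing order, indexed from \<open>0\<close>: the squared nonzero singular
values, which are indexed from \<open>1\<close>, followed by zeros.\<close>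

definition padded_squares :: "nat \<Rightarrow> (nat \<Rightarrow> real) \<Rightarrow> nat \<Rightarrow> real" where
  "padded_squares r \<sigma> i = (if i < r then (\<sigma> (Suc i))\<^sup>2 else 0)"

lemma antimono_padded_squares:
  assumes "antimono_on {1..r} \<sigma>" "\<forall>j \<in> {1..r}. 0 < \<sigma> j"
  shows "antimono (padded_squares r \<sigma>)"
proof (rule antimonoI)
  fix i j :: nat assume ij: "i \<le> j"
  have "(\<sigma> (Suc j))\<^sup>2 \<le> (\<sigma> (Suc i))\<^sup>2" if "j < r"
    by (rule power_mono) (use assms ij that in \<open>auto simp: monotone_on_def intro: less_imp_le\<close>)
  then show "padded_squares r \<sigma> j \<le> padded_squares r \<sigma> i"
    using ij by (auto simp: padded_squares_def)
qed

lemma sum_padded_squares_mult: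
  assumes "r \<le> s" "r \<le> n"
  shows "(\<Sum>i<n. padded_squares r \<sigma> i * padded_squares s \<tau> i) = (\<Sum>j=1..r. (\<sigma> j)\<^sup>2 * (\<tau> j)\<^sup>2)"
proof -
  have "(\<Sum>i<n. padded_squares r \<sigma> i * padded_squares s \<tau> i) = (\<Sum>i<r. (\<sigma> (Suc i))\<^sup>2 * (\<tau> (Suc i))\<^sup>2)"
    by (rule sum.mono_neutral_cong_right) (use assms in \<open>auto simp: padded_squares_def\<close>)
  then show ?thesis by (simp add: sum.atLeast1_atMost_eq)
qed

lemma sum_padded_squares_sq:
  assumes "r \<le> n"
  shows "(\<Sum>i<n. padded_squares r \<sigma> i * padded_squares r \<sigma> i) = (\<Sum>j=1..r. (\<sigma> j) ^ 4)"
  unfolding sum_padded_squares_mult[OF order_refl assms] by (simp add: power_add[symmetric])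

lemma proots_linear_factors: "proots (\<Prod>a\<leftarrow>as. [:- a, 1 :: complex:]) = mset as"
proof (induction as)
  case (Cons a as)
  have "(\<Prod>a\<leftarrow>as. [:- a, 1 :: complex:]) \<noteq> 0" by (auto simp: prod_list_zero_iff)
  then have "proots (\<Prod>a\<leftarrow>a # as. [:- a, 1:]) = proots [:- a, 1:] + proots (\<Prod>a\<leftarrow>as. [:- a, 1:])"
    unfolding list.map prod_list.Cons by (intro proots_mult) auto
  then show ?case unfolding Cons.IH proots_linear_factor by simp
qed simp

lemma upt_1_eq_map_Suc: "[1..<r + 1] = map Suc [0..<r]"
  by (simp add: map_Suc_upt)

text \<open>The roots of the characteristic polynomial of \<open>A\<^sup>* A\<close> are real and nonnegative, so each nonzero
root is recovered from its square root. Hence the multiset of all roots is that of the squared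
singular values together with \<open>n - r\<close> zeros, and listing it in decreasing order in the spectral
theorem yields the stated decomposition.\<close>

lemma nonzero_sing_vals_spectral:
  assumes A: "A \<in> carrier_mat m n" and sv: "nonzero_sing_vals A = map \<sigma> [1..<r + 1]"
  shows "r \<le> n" "antimono_on {1..r} \<sigma>" "\<forall>j \<in> {1..r}. 0 < \<sigma> j"
    and "\<exists>U. unitary_mat n U \<and>
      mat_adjoint A * A = U * mat_diag n (\<lambda>i. complex_of_real (padded_squares r \<sigma> i)) * mat_adjoint U"
proof -
  define P where "P = mat_adjoint A * A"
  have P: "psd_mat n P" unfolding P_def by (rule psd_mat_gram[OF A])
  have Pc: "P \<in> carrier_mat n n" using P by (simp add: psd_mat_def)
  obtain es where cp: "char_poly P = (\<Prod>e\<leftarrow>es. [:- e, 1:])"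
    using char_poly_factorized[OF Pc] by blast
  note len = length_char_poly_factors[OF Pc cp]
  note nn = psd_diagonalization(1)[OF P cp]
  define N where "N = filter_mset (\<lambda>z. z \<noteq> 0) (mset es)"
  have svN: "map \<sigma> [1..<r + 1] = rev (sorted_list_of_multiset (image_mset (\<lambda>z. sqrt (Re z)) N))"
    using sv unfolding nonzero_sing_vals_def P_def[symmetric] cp proots_linear_factors N_def by simp
  have msN: "mset (map \<sigma> [1..<r + 1]) = image_mset (\<lambda>z. sqrt (Re z)) N"
    unfolding svN by simp
  have N_pos: "z = complex_of_real ((sqrt (Re z))\<^sup>2) \<and> 0 < sqrt (Re z)" if "z \<in># N" for z
  proof -
    have "z \<in> set es" "z \<noteq> 0" using that by (auto simp: N_def)
    moreover have "Re z \<noteq> 0" using calculation nn by (metis of_real_0)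
    ultimately show ?thesis using nn by (auto simp: less_le)
  qed
  have "size N \<le> n" unfolding N_def using size_filter_mset_lesseq[of _ "mset es"] len by simp
  moreover have "size N = r" using arg_cong[OF msN, of size] by (simp del: upt_Suc)
  ultimately show rn: "r \<le> n" by simp
  show pos: "\<forall>j \<in> {1..r}. 0 < \<sigma> j"
  proof
    fix j assume "j \<in> {1..r}"
    then have "\<sigma> j \<in># mset (map \<sigma> [1..<r + 1])" by (simp del: upt_Suc)
    then show "0 < \<sigma> j" unfolding msN using N_pos by auto
  qed
  have sorted: "sorted_wrt (\<ge>) (map \<sigma> [1..<r + 1])"
    unfolding svN sorted_wrt_rev by simp
  show anti: "antimono_on {1..r} \<sigma>"
  proof (rule monotone_onI)
    fix i j assume ij: "i \<in> {1..r}" "j \<in> {1..r}" "i \<le> j"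
    show "\<sigma> j \<le> \<sigma> i"
    proof (cases "i = j")
      case False
      then show ?thesis using sorted_wrt_nth_less[OF sorted, of "i - 1" "j - 1"] ij
        by (auto simp: nth_append simp del: upt_Suc)
    qed simp
  qed
  \<comment> \<open>Squaring undoes the square root on each nonzero eigenvalue.\<close>
  have "N = image_mset (\<lambda>x. complex_of_real (x\<^sup>2)) (image_mset (\<lambda>z. sqrt (Re z)) N)"
    unfolding multiset.map_comp o_def using N_pos by (metis (mono_tags, lifting) image_mset_cong multiset.map_ident)
  then have N: "N = mset (map (\<lambda>j. complex_of_real ((\<sigma> j)\<^sup>2)) [1..<r + 1])"
    unfolding msN[symmetric] by (simp del: upt_Suc add: multiset.map_comp o_def)
  \<comment> \<open>The wanted order of the eigenvalues; it remains to see that it lists the same multiset as \<open>es\<close>.\<close>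
  define fs where "fs = map (\<lambda>i. complex_of_real (padded_squares r \<sigma> i)) [0..<n]"
  have "fs = map (\<lambda>j. complex_of_real ((\<sigma> j)\<^sup>2)) [1..<r + 1] @ replicate (n - r) 0"
  proof (rule nth_equalityI)
    fix i assume "i < length fs"
    then show "fs ! i = (map (\<lambda>j. complex_of_real ((\<sigma> j)\<^sup>2)) [1..<r + 1] @ replicate (n - r) 0) ! i"
      by (auto simp: fs_def nth_append padded_squares_def simp del: upt_Suc)
  qed (use rn in \<open>simp add: fs_def del: upt_Suc\<close>)
  then have "mset fs = N + replicate_mset (n - r) 0" unfolding N by simp
  also have "replicate_mset (n - r) 0 = filter_mset (\<lambda>z. \<not> z \<noteq> 0) (mset es)"
  proof -
    have "size (filter_mset (\<lambda>z. \<not> z \<noteq> 0) (mset es)) = n - r"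
      using size_union[of N "filter_mset (\<lambda>z. \<not> z \<noteq> 0) (mset es)"] len \<open>size N = r\<close>
      unfolding N_def multiset_partition[symmetric] by simp
    then show ?thesis by (simp add: filter_eq_replicate_mset)
  qed
  also have "N + \<dots> = mset es" unfolding N_def by (rule multiset_partition[symmetric])
  finally have "mset fs = mset es" .
  then have "(\<Prod>e\<leftarrow>fs. [:- e, 1:]) = (\<Prod>e\<leftarrow>es. [:- e, 1:])"
    by (metis mset_map prod_mset_prod_list)
  then have cp': "char_poly P = (\<Prod>e\<leftarrow>fs. [:- e, 1:])" using cp by simp
  have "mat_diag n (\<lambda>i. fs ! i) = mat_diag n (\<lambda>i. complex_of_real (padded_squares r \<sigma> i))"
    by (intro eq_matI) (auto simp: mat_diag_def fs_def)
  then show "\<exists>U. unitary_mat n U \<and>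
      mat_adjoint A * A = U * mat_diag n (\<lambda>i. complex_of_real (padded_squares r \<sigma> i)) * mat_adjoint U"
    using psd_diagonalization(2)[OF P cp'] unfolding P_def by simp
qed

section \<open>The inequality\<close>

text \<open>Both Frobenius norms depend on \<open>A\<close> and \<open>B\<close> only through the Gram matrices \<open>P = A\<^sup>* A\<close> and
\<open>Q = B\<^sup>* B\<close>; for \<open>\<parallel>A B\<^sup>*\<parallel>\<^sub>F\<close> this is cyclicity of the trace.\<close>

lemma frob_norm_mult_adjoint_sq:
  assumes A: "A \<in> carrier_mat m n" and B: "B \<in> carrier_mat m n"
  shows "(frob_norm (A * mat_adjoint B))\<^sup>2 = Re (mat_trace (mat_adjoint A * A * (mat_adjoint B * B)))"
proof -
  note Aa = mat_adjoint_carrier[OF A] and Ba = mat_adjoint_carrier[OF B]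
  have AA: "mat_adjoint A * A \<in> carrier_mat n n" and AB: "A * mat_adjoint B \<in> carrier_mat m m"
    and BA: "B * mat_adjoint A \<in> carrier_mat m m"
    by (rule mult_carrier_mat[OF Aa A] mult_carrier_mat[OF A Ba] mult_carrier_mat[OF B Aa])+
  have "complex_of_real ((frob_norm (A * mat_adjoint B))\<^sup>2) =
      mat_trace (B * mat_adjoint A * (A * mat_adjoint B))"
    unfolding frob_norm_sq_trace mat_adjoint_mult[OF A Ba] by simp
  also have "B * mat_adjoint A * (A * mat_adjoint B) = B * (mat_adjoint A * A * mat_adjoint B)"
    unfolding assoc_mult_mat[OF B Aa AB] assoc_mult_mat[OF Aa A Ba] ..
  also have "mat_trace \<dots> = mat_trace (mat_adjoint A * A * mat_adjoint B * B)"
    by (rule mat_trace_comm[OF B mult_carrier_mat[OF AA Ba]])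
  also have "mat_adjoint A * A * mat_adjoint B * B = mat_adjoint A * A * (mat_adjoint B * B)"
    by (rule assoc_mult_mat[OF AA Ba B])
  finally show ?thesis by (metis Re_complex_of_real)
qed

lemma frob_norm_abs_sum_sq:
  assumes A: "A \<in> carrier_mat m n" and B: "B \<in> carrier_mat m n"
  defines "P \<equiv> mat_adjoint A * A" and "Q \<equiv> mat_adjoint B * B"
  shows "(frob_norm (mat_abs A ^\<^sub>m 2 + mat_abs B ^\<^sub>m 2))\<^sup>2 =
    Re (mat_trace (P * P)) + Re (mat_trace (Q * Q)) + 2 * Re (mat_trace (P * Q))"
proof -
  have P: "P \<in> carrier_mat n n" "mat_adjoint P = P" and Q: "Q \<in> carrier_mat n n" "mat_adjoint Q = Q"
    using psd_mat_gram[OF A] psd_mat_gram[OF B] by (auto simp: psd_mat_def P_def Q_def)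
  note c = square_mult_closed[OF P(1) P(1)] square_mult_closed[OF P(1) Q(1)]
    square_mult_closed[OF Q(1) P(1)] square_mult_closed[OF Q(1) Q(1)]
  have "complex_of_real ((frob_norm (P + Q))\<^sup>2) = mat_trace ((P + Q) * (P + Q))"
    unfolding frob_norm_sq_trace mat_adjoint_add[OF P(1) Q(1)] P(2) Q(2) ..
  also have "(P + Q) * (P + Q) = (P * P + Q * P) + (P * Q + Q * Q)"
    using P(1) Q(1) by (simp add: mult_add_distrib_mat[of _ n n _ n] add_mult_distrib_mat[of _ n n _ _ n])
  also have "mat_trace \<dots> = mat_trace (P * P) + mat_trace (Q * P) + (mat_trace (P * Q) + mat_trace (Q * Q))"
    using c by (simp add: mat_trace_add[of _ n])
  also have "mat_trace (Q * P) = mat_trace (P * Q)" by (rule mat_trace_comm[OF Q(1) P(1)])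
  finally have "complex_of_real ((frob_norm (P + Q))\<^sup>2) =
      mat_trace (P * P) + mat_trace (P * Q) + (mat_trace (P * Q) + mat_trace (Q * Q))" .
  from arg_cong[OF this, of Re] show ?thesis
    unfolding mat_abs_square[OF A] mat_abs_square[OF B] P_def[symmetric] Q_def[symmetric] by simp
qed

lemma mat_trace_spectral_sq:
  assumes U: "unitary_mat n U" and P: "P = U * mat_diag n (\<lambda>i. complex_of_real (a i)) * mat_adjoint U"
  shows "Re (mat_trace (P * P)) = (\<Sum>i<n. a i * a i)"
  unfolding P unitary_diag_mult[OF U] mat_trace_unitary_diag[OF U] by simp

text \<open>The quotient \<open>t / (S + 2 t)\<close> increases with \<open>t\<close>.\<close>

lemma fraction_bound:
  fixes S T t :: real
  assumes "0 < S" "0 \<le> t" "t \<le> T"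
  shows "sqrt t \<le> sqrt (T / (S + 2 * T)) * sqrt (S + 2 * t)"
proof -
  have "t * (S + 2 * T) \<le> T * (S + 2 * t)"
    using mult_right_mono[OF assms(3), of S] assms(1) by (simp add: algebra_simps)
  then have "t \<le> T / (S + 2 * T) * (S + 2 * t)"
    using assms by (simp add: field_simps)
  then show ?thesis unfolding real_sqrt_mult[symmetric] by (rule real_sqrt_le_mono)
qed

lemma sum_fourth_powers_pos:
  fixes \<sigma> :: "nat \<Rightarrow> real"
  assumes "1 \<le> r" "\<forall>j \<in> {1..r}. 0 < \<sigma> j"
  shows "0 < (\<Sum>j=1..r. (\<sigma> j) ^ 4)"
  using assms by (intro sum_pos zero_less_power) simp_all

theorem frob_norm_mult_adjoint_le:
  assumes r: "1 \<le> r" "r \<le> s"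
    and A: "A \<in> carrier_mat m n" and B: "B \<in> carrier_mat m n"
    and svA: "nonzero_sing_vals A = map \<sigma> [1..<r + 1]" and svB: "nonzero_sing_vals B = map \<tau> [1..<s + 1]"
  shows "frob_norm (A * mat_adjoint B)
    \<le> sv_coeff r s \<sigma> \<tau> * frob_norm (mat_abs A ^\<^sub>m 2 + mat_abs B ^\<^sub>m 2)"
proof -
  define P Q where "P = mat_adjoint A * A" and "Q = mat_adjoint B * B"
  note a = nonzero_sing_vals_spectral[OF A svA] and b = nonzero_sing_vals_spectral[OF B svB]
  obtain U where U: "unitary_mat n U"
    and PU: "P = U * mat_diag n (\<lambda>i. complex_of_real (padded_squares r \<sigma> i)) * mat_adjoint U"
    using a(4) unfolding P_def by blast
  obtain V where V: "unitary_mat n V"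
    and QV: "Q = V * mat_diag n (\<lambda>i. complex_of_real (padded_squares s \<tau> i)) * mat_adjoint V"
    using b(4) unfolding Q_def by blast
  define S where "S = (\<Sum>j=1..r. (\<sigma> j) ^ 4) + (\<Sum>j=1..s. (\<tau> j) ^ 4)"
  define T where "T = (\<Sum>j=1..r. (\<sigma> j)\<^sup>2 * (\<tau> j)\<^sup>2)"
  define t where "t = Re (mat_trace (P * Q))"
  have "t \<le> (\<Sum>i<n. padded_squares r \<sigma> i * padded_squares s \<tau> i)"
    unfolding t_def PU QV
    by (intro von_neumann_trace_inequality[OF U V] antimono_padded_squares a(2,3) b(2,3))
      (use a(1) b(1) in \<open>simp_all add: padded_squares_def\<close>)
  then have tT: "t \<le> T" unfolding sum_padded_squares_mult[OF r(2) a(1)] T_def .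
  have F1: "(frob_norm (A * mat_adjoint B))\<^sup>2 = t"
    unfolding frob_norm_mult_adjoint_sq[OF A B] t_def P_def Q_def ..
  have F2: "(frob_norm (mat_abs A ^\<^sub>m 2 + mat_abs B ^\<^sub>m 2))\<^sup>2 = S + 2 * t"
    unfolding frob_norm_abs_sum_sq[OF A B] P_def[symmetric] Q_def[symmetric] t_def S_def
      mat_trace_spectral_sq[OF U PU] mat_trace_spectral_sq[OF V QV]
      sum_padded_squares_sq[OF a(1)] sum_padded_squares_sq[OF b(1)] ..
  have "0 < S" unfolding S_def
    using sum_fourth_powers_pos[OF r(1) a(3)] sum_fourth_powers_pos[of s \<tau>] r b(3) by simp
  moreover have "0 \<le> t" unfolding F1[symmetric] by simp
  ultimately have "sqrt t \<le> sqrt (T / (S + 2 * T)) * sqrt (S + 2 * t)" using tT by (rule fraction_bound)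
  moreover have "sqrt t = frob_norm (A * mat_adjoint B)"
    unfolding F1[symmetric] using frob_norm_nonneg by simp
  moreover have "sqrt (S + 2 * t) = frob_norm (mat_abs A ^\<^sub>m 2 + mat_abs B ^\<^sub>m 2)"
    unfolding F2[symmetric] using frob_norm_nonneg by simp
  moreover have "sv_coeff r s \<sigma> \<tau> = sqrt (T / (S + 2 * T))"
    unfolding sv_coeff_def S_def T_def ..
  ultimately show ?thesis by simp
qed

section \<open>Sharpness: rectangular diagonal matrices\<close>

definition rect_diag :: "nat \<Rightarrow> nat \<Rightarrow> nat \<Rightarrow> (nat \<Rightarrow> real) \<Rightarrow> complex mat" where
  "rect_diag m n r \<sigma> = mat m n (\<lambda>(i, j). if i = j \<and> i < r then complex_of_real (\<sigma> (Suc i)) else 0)"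

lemma rect_diag_carrier: "rect_diag m n r \<sigma> \<in> carrier_mat m n"
  by (simp add: rect_diag_def)

lemma rect_diag_gram:
  assumes "r \<le> m"
  shows "mat_adjoint (rect_diag m n r \<sigma>) * rect_diag m n r \<sigma> =
    mat_diag n (\<lambda>i. complex_of_real (padded_squares r \<sigma> i))"
proof (rule eq_matI)
  fix i j assume "i < dim_row (mat_diag n (\<lambda>i. complex_of_real (padded_squares r \<sigma> i)))"
    "j < dim_col (mat_diag n (\<lambda>i. complex_of_real (padded_squares r \<sigma> i)))"
  then have ij: "i < n" "j < n" by (auto simp: mat_diag_def)
  let ?A = "rect_diag m n r \<sigma>"
  note A = rect_diag_carrier[of m n r \<sigma>]
  have "(mat_adjoint ?A * ?A) $$ (i, j) = (\<Sum>l<m. mat_adjoint ?A $$ (i, l) * ?A $$ (l, j))"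
    by (rule mult_index_sum[OF mat_adjoint_carrier[OF A] A ij])
  also have "\<dots> = (\<Sum>l<m. if l = i then (if i = j \<and> i < r then complex_of_real ((\<sigma> (Suc i))\<^sup>2) else 0) else 0)"
    using ij by (intro sum.cong refl) (auto simp: rect_diag_def power2_eq_square)
  also have "\<dots> = mat_diag n (\<lambda>i. complex_of_real (padded_squares r \<sigma> i)) $$ (i, j)"
    using ij assms by (auto simp: mat_diag_def padded_squares_def)
  finally show "(mat_adjoint ?A * ?A) $$ (i, j) = mat_diag n (\<lambda>i. complex_of_real (padded_squares r \<sigma> i)) $$ (i, j)" .
qed (auto simp: rect_diag_def mat_diag_def)

text \<open>The Gram matrix is diagonal, so its characteristic polynomial displays the eigenvalues. Positivity
of \<open>\<sigma>\<close> ensures that discarding zero eigenvalues removes exactly the padding, and monotonicity that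
sorting the square roots gives back \<open>\<sigma>\<close> itself.\<close>

lemma nonzero_sing_vals_rect_diag:
  assumes "r \<le> m" "r \<le> n" and anti: "antimono_on {1..r} \<sigma>" and pos: "\<forall>j \<in> {1..r}. 0 < \<sigma> j"
  shows "nonzero_sing_vals (rect_diag m n r \<sigma>) = map \<sigma> [1..<r + 1]"
proof -
  let ?f = "\<lambda>i. complex_of_real (padded_squares r \<sigma> i)"
  have "upper_triangular (mat_diag n ?f)" by (auto simp: mat_diag_def)
  then have cp: "char_poly (mat_diag n ?f) = (\<Prod>a\<leftarrow>map ?f [0..<n]. [:- a, 1:])"
    by (subst char_poly_upper_triangular[of _ n]) (auto simp: diag_mat_def mat_diag_def intro!: arg_cong[where f = prod_list])
  have split: "[0..<n] = [0..<r] @ [r..<n]"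
    using assms(2) by (metis le0 upt_add_eq_append le_add_diff_inverse)
  have \<sigma>: "0 < \<sigma> (Suc i)" if "i < r" for i using pos that by simp
  then have "filter (\<lambda>z. z \<noteq> 0) (map ?f [0..<n]) = map ?f [0..<r]"
    unfolding split map_append filter_append
    by (subst filter_True) (auto simp: padded_squares_def filter_empty_conv less_imp_neq[symmetric])
  then have flt: "filter_mset (\<lambda>z. z \<noteq> 0) (mset (map ?f [0..<n])) = mset (map ?f [0..<r])"
    by (metis mset_filter)
  have "map (\<lambda>z. sqrt (Re z)) (map ?f [0..<r]) = map \<sigma> [1..<r + 1]"
    unfolding upt_1_eq_map_Suc map_map o_def
    by (rule map_cong) (use \<sigma> in \<open>auto simp: padded_squares_def less_imp_le\<close>)
  then have img: "image_mset (\<lambda>z. sqrt (Re z)) (mset (map ?f [0..<r])) = mset (map \<sigma> [1..<r + 1])"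
    by (metis mset_map)
  have "sorted (rev (map \<sigma> [1..<r + 1]))"
    unfolding sorted_wrt_rev upt_1_eq_map_Suc map_map sorted_wrt_map
    by (rule sorted_wrt_mono_rel[OF _ sorted_wrt_upt])
      (use anti in \<open>auto simp: monotone_on_def\<close>)
  then have srt: "sorted_list_of_multiset (mset (map \<sigma> [1..<r + 1])) = rev (map \<sigma> [1..<r + 1])"
    by (metis mset_rev sorted_list_of_multiset_mset sorted_sort_id)
  show ?thesis
    unfolding nonzero_sing_vals_def rect_diag_gram[OF assms(1)] cp proots_linear_factors flt img srt by simp
qed

text \<open>The first \<open>r\<close> columns are nonzero multiples of distinct unit vectors and the other columns vanish,
so the former are a maximal independent set of columns.\<close>

lemma rank_rect_diag:
  assumes rm: "r \<le> m" and rn: "r \<le> n" and pos: "\<forall>j \<in> {1..r}. 0 < \<sigma> j"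
  shows "rect_diag m n r \<sigma> \<in> rank_mats m n r"
proof -
  interpret vec_space "TYPE(complex)" m .
  let ?A = "rect_diag m n r \<sigma>" and ?C = "rect_diag m r r \<sigma>"
  have C: "?C \<in> carrier_mat m r" and A: "?A \<in> carrier_mat m n" by (rule rect_diag_carrier)+
  have \<sigma>: "\<sigma> (Suc i) \<noteq> 0" if "i < r" for i using pos that by (metis atLeastAtMost_iff less_irrefl le_add1 plus_1_eq_Suc Suc_leI)
  have colA: "col ?A j = (if j < r then col ?C j else 0\<^sub>v m)" if "j < n" for j
    using that by (intro eq_vecI) (auto simp: rect_diag_def)
  have dist: "distinct (cols ?C)"
    unfolding distinct_conv_nth
  proof (intro allI impI)
    fix i j assume ij: "i < length (cols ?C)" "j < length (cols ?C)" "i \<noteq> j"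
    then have "i < r" "j < r" using C by auto
    then have "col ?C i $ i \<noteq> col ?C j $ i" using rm ij(3) \<sigma> by (simp add: rect_diag_def)
    then show "cols ?C ! i \<noteq> cols ?C ! j" using \<open>i < r\<close> \<open>j < r\<close> C by (auto simp del: index_col)
  qed
  have indpt: "lin_indpt (set (cols ?C))"
  proof
    assume "lin_dep (set (cols ?C))"
    then obtain v where v: "v \<in> carrier_vec r" "v \<noteq> 0\<^sub>v r" "?C *\<^sub>v v = 0\<^sub>v m"
      by (rule lin_depE[OF C _ dist])
    have "v = 0\<^sub>v r"
    proof (rule eq_vecI)
      fix i assume "i < dim_vec (0\<^sub>v r :: complex vec)"
      then have i: "i < r" by simp
      have "(?C *\<^sub>v v) $ i = (\<Sum>j<r. ?C $$ (i, j) * v $ j)"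
        using i rm v(1) C by (simp add: scalar_prod_def atLeast0LessThan)
      also have "\<dots> = (\<Sum>j<r. if j = i then complex_of_real (\<sigma> (Suc i)) * v $ i else 0)"
        using i rm by (intro sum.cong refl) (auto simp: rect_diag_def)
      also have "\<dots> = complex_of_real (\<sigma> (Suc i)) * v $ i" using i by simp
      finally show "v $ i = 0\<^sub>v r $ i" using v(3) i rm \<sigma>[OF i] by simp
    qed (use v(1) in simp)
    with v(2) show False ..
  qed
  have cols_sub: "set (cols ?C) \<subseteq> set (cols ?A)"
  proof
    fix x assume "x \<in> set (cols ?C)"
    then obtain j where "j < r" "x = col ?C j" using C by (auto simp: cols_def)
    then show "x \<in> set (cols ?A)" using colA[of j] rn A by (auto simp: cols_def intro!: image_eqI[of _ _ j])
  qed
  have "maximal (set (cols ?C)) (\<lambda>T. T \<subseteq> set (cols ?A) \<and> lin_indpt T)"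
    unfolding maximal_def
  proof (intro conjI allI impI cols_sub indpt)
    fix T assume T: "set (cols ?C) \<subseteq> T \<and> T \<subseteq> set (cols ?A) \<and> lin_indpt T"
    have "(UNIV :: complex set) \<noteq> {0}" by (metis UNIV_I one_neq_zero singletonD)
    then have "0\<^sub>v m \<notin> T"
      using T zero_lin_dep[of T] by (auto simp: class_ring_simps module_vec_simps)
    moreover have "set (cols ?A) \<subseteq> set (cols ?C) \<union> {0\<^sub>v m}"
      using colA A C by (auto simp: cols_def split: if_splits)
    ultimately show "T = set (cols ?C)" using T by blast
  qed
  then have "rank ?A = card (set (cols ?C))" by (rule rank_card_indpt[OF A])
  also have "\<dots> = r" using distinct_card[OF dist] C by simp
  finally show ?thesis using A by (simp add: rank_mats_def)
qed

text \<open>Both Gram matrices are diagonal in the standard basis, so the trace of their product is exactly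
the sum of the \<open>\<sigma>\<^sub>j\<^sup>2 \<tau>\<^sub>j\<^sup>2\<close>. Positivity of the norm on the right makes the equality determine the
coefficient.\<close>

theorem rect_diag_equality:
  fixes \<sigma> \<tau> :: "nat \<Rightarrow> real"
  assumes r: "1 \<le> r" "r \<le> s" and mn: "s \<le> min m n" and pos: "\<forall>j \<in> {1..r}. 0 < \<sigma> j"
  defines "A \<equiv> rect_diag m n r \<sigma>" and "B \<equiv> rect_diag m n s \<tau>"
  shows "frob_norm (A * mat_adjoint B)
      = sv_coeff r s \<sigma> \<tau> * frob_norm (mat_abs A ^\<^sub>m 2 + mat_abs B ^\<^sub>m 2)"
    and "0 < frob_norm (mat_abs A ^\<^sub>m 2 + mat_abs B ^\<^sub>m 2)"
proof -
  have bounds: "r \<le> m" "r \<le> n" "s \<le> m" "s \<le> n" using r mn by auto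
  have A: "A \<in> carrier_mat m n" and B: "B \<in> carrier_mat m n" by (simp_all add: A_def B_def rect_diag_carrier)
  note gram = rect_diag_gram[OF bounds(1), of n \<sigma>, folded A_def] rect_diag_gram[OF bounds(3), of n \<tau>, folded B_def]
  define S where "S = (\<Sum>j=1..r. (\<sigma> j) ^ 4) + (\<Sum>j=1..s. (\<tau> j) ^ 4)"
  define T where "T = (\<Sum>j=1..r. (\<sigma> j)\<^sup>2 * (\<tau> j)\<^sup>2)"
  have tr: "Re (mat_trace (mat_diag n (\<lambda>i. complex_of_real (f i)) * mat_diag n (\<lambda>i. complex_of_real (g i))))
     = (\<Sum>i<n. f i * g i)" for f g :: "nat \<Rightarrow> real"
    unfolding mat_diag_diag by (simp add: mat_trace_def mat_diag_def)
  have F1: "(frob_norm (A * mat_adjoint B))\<^sup>2 = T"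
    unfolding frob_norm_mult_adjoint_sq[OF A B] gram tr sum_padded_squares_mult[OF r(2) bounds(2)] T_def ..
  have F2: "(frob_norm (mat_abs A ^\<^sub>m 2 + mat_abs B ^\<^sub>m 2))\<^sup>2 = S + 2 * T"
    unfolding frob_norm_abs_sum_sq[OF A B] gram tr sum_padded_squares_mult[OF r(2) bounds(2)]
      sum_padded_squares_sq[OF bounds(2)] sum_padded_squares_sq[OF bounds(4)] T_def S_def ..
  have "0 \<le> (\<Sum>j=1..s. (\<tau> j) ^ 4)" by (intro sum_nonneg) simp
  then have S: "0 < S" unfolding S_def using sum_fourth_powers_pos[OF r(1) pos] by linarith
  have T: "0 \<le> T" unfolding F1[symmetric] by simp
  have eq1: "frob_norm (A * mat_adjoint B) = sqrt T" unfolding F1[symmetric] using frob_norm_nonneg by simp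
  have eq2: "frob_norm (mat_abs A ^\<^sub>m 2 + mat_abs B ^\<^sub>m 2) = sqrt (S + 2 * T)"
    unfolding F2[symmetric] using frob_norm_nonneg by simp
  have co: "sv_coeff r s \<sigma> \<tau> = sqrt (T / (S + 2 * T))" unfolding sv_coeff_def S_def T_def ..
  show "frob_norm (A * mat_adjoint B)
      = sv_coeff r s \<sigma> \<tau> * frob_norm (mat_abs A ^\<^sub>m 2 + mat_abs B ^\<^sub>m 2)"
    unfolding eq1 eq2 co real_sqrt_mult[symmetric] using S T by simp
  show "0 < frob_norm (mat_abs A ^\<^sub>m 2 + mat_abs B ^\<^sub>m 2)" unfolding eq2 using S T by simp
qed

theorem theorem1p17:
  fixes m n r s :: nat and \<sigma> \<tau> :: "nat \<Rightarrow> real"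
  assumes "1 \<le> r" and "r \<le> s"
  shows "(\<forall>A \<in> rank_mats m n r. \<forall>B \<in> rank_mats m n s.
            nonzero_sing_vals A = map \<sigma> [1..<r + 1] \<longrightarrow>
            nonzero_sing_vals B = map \<tau> [1..<s + 1] \<longrightarrow>
            frob_norm (A * mat_adjoint B)
              \<le> sv_coeff r s \<sigma> \<tau> * frob_norm (mat_abs A ^\<^sub>m 2 + mat_abs B ^\<^sub>m 2)) \<and>
         (s \<le> min m n \<longrightarrow>
          antimono_on {1..r} \<sigma> \<longrightarrow> (\<forall>j \<in> {1..r}. 0 < \<sigma> j) \<longrightarrow>
          antimono_on {1..s} \<tau> \<longrightarrow> (\<forall>j \<in> {1..s}. 0 < \<tau> j) \<longrightarrow>
          (\<forall>c :: real.
             (\<forall>A \<in> rank_mats m n r. \<forall>B \<in> rank_mats m n s.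
                nonzero_sing_vals A = map \<sigma> [1..<r + 1] \<longrightarrow>
                nonzero_sing_vals B = map \<tau> [1..<s + 1] \<longrightarrow>
                frob_norm (A * mat_adjoint B)
                  \<le> c * frob_norm (mat_abs A ^\<^sub>m 2 + mat_abs B ^\<^sub>m 2))
             \<longrightarrow> sv_coeff r s \<sigma> \<tau> \<le> c))"
proof (intro conjI ballI impI allI)
  fix A B assume "A \<in> rank_mats m n r" "B \<in> rank_mats m n s"
    and "nonzero_sing_vals A = map \<sigma> [1..<r + 1]" "nonzero_sing_vals B = map \<tau> [1..<s + 1]"
  then show "frob_norm (A * mat_adjoint B)
      \<le> sv_coeff r s \<sigma> \<tau> * frob_norm (mat_abs A ^\<^sub>m 2 + mat_abs B ^\<^sub>m 2)"
    using frob_norm_mult_adjoint_le[OF assms, of A m n B] by (simp add: rank_mats_def)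
next
  fix c :: real
  assume mn: "s \<le> min m n"
    and \<sigma>: "antimono_on {1..r} \<sigma>" "\<forall>j \<in> {1..r}. 0 < \<sigma> j"
    and \<tau>: "antimono_on {1..s} \<tau>" "\<forall>j \<in> {1..s}. 0 < \<tau> j"
    and c: "\<forall>A \<in> rank_mats m n r. \<forall>B \<in> rank_mats m n s.
                nonzero_sing_vals A = map \<sigma> [1..<r + 1] \<longrightarrow>
                nonzero_sing_vals B = map \<tau> [1..<s + 1] \<longrightarrow>
                frob_norm (A * mat_adjoint B)
                  \<le> c * frob_norm (mat_abs A ^\<^sub>m 2 + mat_abs B ^\<^sub>m 2)"
  have bounds: "r \<le> m" "r \<le> n" "s \<le> m" "s \<le> n" using assms mn by auto
  \<comment> \<open>The equality case turns any admissible \<open>c\<close> into an upper bound for the coefficient.\<close>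
  let ?A = "rect_diag m n r \<sigma>" and ?B = "rect_diag m n s \<tau>"
  have "frob_norm (?A * mat_adjoint ?B) \<le> c * frob_norm (mat_abs ?A ^\<^sub>m 2 + mat_abs ?B ^\<^sub>m 2)"
    using c rank_rect_diag[OF bounds(1,2) \<sigma>(2)] rank_rect_diag[OF bounds(3,4) \<tau>(2)]
      nonzero_sing_vals_rect_diag[OF bounds(1,2) \<sigma>] nonzero_sing_vals_rect_diag[OF bounds(3,4) \<tau>]
    by blast
  then show "sv_coeff r s \<sigma> \<tau> \<le> c"
    unfolding rect_diag_equality(1)[OF assms mn \<sigma>(2)]
    using rect_diag_equality(2)[OF assms mn \<sigma>(2), of \<tau>] by (simp only: mult_le_cancel_right_pos)
qed

end
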